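(* Every non-decreasing pure $O$-sequence $\underline{h}=(h_0,\dots,h_e)$ of socle degree $e\le 3$ is differentiable.
   Context: For positive integers $n,d$, write $n=\binom{k_d}{d}+\cdots+\binom{k_\delta}{\delta}$ with $k_d>\dots>k_\delta\ge\delta\ge1$ (unique $d$-binomial expansion) and set $(n_{(d)})^1_1=\binom{k_d+1}{d+1}+\cdots+\binom{k_\delta+1}{\delta+1}$; set $(0_{(d)})^1_1=0$. A sequence $(h_0,\dots,h_e)$ of non-negative integers with $h_0=1$ is an $O$-sequence if $h_{d+1}\le((h_d)_{(d)})^1_1$ for all $1\le d<e$. A monomial order ideal is a finite nonempty set of monomials closed under taking divisors; it is pure if all its maximal monomials under divisibility have the same degree $e$, called the socle degree. A pure $O$-sequence is the vector $(h_0,\dots,h_e)$ counting the monomials of each degree in a pure monomial order ideal of socle degree $e$. A sequence is non-decreasing if $h_{i+1}\ge h_i$ for all $i$, and differentiable if $(h_0,h_1-h_0,\dots,h_e-h_{e-1})$ is an $O$-sequence. *)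

theory Defs
  imports Complex_Main "HOL-Library.Multiset"
begin

text \<open>
  The coefficients of an expansion are indexed by the lower entries of the binomials, so only the
  values \<open>k \<delta>, \<dots>, k d\<close> matter.
\<close>

definition binomial_expansion :: "nat \<Rightarrow> nat \<Rightarrow> nat \<Rightarrow> (nat \<Rightarrow> nat) \<Rightarrow> bool" where
  "binomial_expansion d n \<delta> k \<longleftrightarrow>
     1 \<le> \<delta> \<and> \<delta> \<le> d \<and> (\<forall>i. \<delta> \<le> i \<and> i < d \<longrightarrow> k i < k (Suc i)) \<and> \<delta> \<le> k \<delta> \<and>
     n = (\<Sum>i=\<delta>..d. k i choose i)"

text \<open>\<open>macaulay_growth d n\<close> is \<open>(n\<^sub>(\<^sub>d\<^sub>))\<^sup>1\<^sub>1\<close>; the description is well defined for \<open>d, n \<ge> 1\<close> by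
  \<open>binomial_expansion_exists\<close> and \<open>macaulay_growth_eq\<close> below.\<close>

definition macaulay_growth :: "nat \<Rightarrow> nat \<Rightarrow> nat" where
  "macaulay_growth d n =
     (if n = 0 then 0
      else THE m. \<exists>\<delta> k. binomial_expansion d n \<delta> k \<and>
                        m = (\<Sum>i=\<delta>..d. (k i + 1) choose (i + 1)))"

lemma binomial_expansion_less:
  assumes "binomial_expansion d n \<delta> k"
  shows "n < (k d + 1) choose d"
proof -
  have \<delta>: "1 \<le> \<delta>" "\<delta> \<le> d" "\<delta> \<le> k \<delta>" and n: "n = (\<Sum>i=\<delta>..d. k i choose i)"
    and mono: "\<And>i. \<delta> \<le> i \<Longrightarrow> i < d \<Longrightarrow> k i < k (Suc i)"
    using assms by (auto simp: binomial_expansion_def)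
  have "e \<le> d \<Longrightarrow> (\<Sum>i=\<delta>..e. k i choose i) < (k e + 1) choose e" if "\<delta> \<le> e" for e
    using that
  proof (induction e rule: dec_induct)
    case base
    obtain c where c: "\<delta> = Suc c" using \<delta>(1) by (cases \<delta>) auto
    then have "0 < k \<delta> choose c" using \<delta>(3) by (intro zero_less_binomial) simp
    then show ?case using c by simp
  next
    case (step e)
    have "(\<Sum>i=\<delta>..Suc e. k i choose i) = (\<Sum>i=\<delta>..e. k i choose i) + (k (Suc e) choose Suc e)"
      using step.hyps by simp
    also have "\<dots> < ((k e + 1) choose e) + (k (Suc e) choose Suc e)"
      using step by simp
    also have "\<dots> \<le> (k (Suc e) choose e) + (k (Suc e) choose Suc e)"
      using mono[of e] step by (intro add_right_mono binomial_right_mono) auto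
    finally show ?case by simp
  qed
  then show ?thesis using \<delta>(2) n by simp
qed

lemma binomial_expansion_ge:
  assumes "binomial_expansion d n \<delta> k"
  shows "k d choose d \<le> n"
  using assms unfolding binomial_expansion_def by (auto intro: member_le_sum)

lemma binomial_expansion_top:
  assumes "binomial_expansion d n \<delta> k" "binomial_expansion d n \<delta>' k'"
  shows "k d = k' d"
proof -
  have *: "\<not> k d < k' d"
    if "binomial_expansion d n \<delta> k" "binomial_expansion d n \<delta>' k'" for \<delta> \<delta>' k k'
  proof
    assume "k d < k' d"
    then have "(k d + 1) choose d \<le> k' d choose d" by (intro binomial_right_mono) simp
    then show False
      using binomial_expansion_less[OF that(1)] binomial_expansion_ge[OF that(2)] by simp
  qed
  show ?thesis using *[OF assms] *[OF assms(2,1)] by simp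
qed

lemma binomial_expansion_pos:
  assumes "binomial_expansion d n \<delta> k"
  shows "0 < n"
proof -
  have "0 < k \<delta> choose \<delta>" using assms by (auto simp: binomial_expansion_def)
  also have "\<dots> \<le> n" using assms by (auto simp: binomial_expansion_def intro: member_le_sum)
  finally show ?thesis .
qed

lemma binomial_expansion_Suc:
  assumes "binomial_expansion (Suc d) n \<delta> k" "\<delta> \<noteq> Suc d"
  shows "binomial_expansion d (n - (k (Suc d) choose Suc d)) \<delta> k"
  using assms by (auto simp: binomial_expansion_def)

lemma binomial_expansion_unique:
  assumes "binomial_expansion d n \<delta> k" "binomial_expansion d n \<delta>' k'"
  shows "\<delta> = \<delta>' \<and> (\<forall>i\<in>{\<delta>..d}. k i = k' i)"
  using assms
proof (induction d arbitrary: n)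
  case 0
  then show ?case by (simp add: binomial_expansion_def)
next
  case (Suc d)
  note top = binomial_expansion_top[OF Suc.prems]
  have *: "n = k (Suc d) choose Suc d" if "binomial_expansion (Suc d) n (Suc d) k" for k
    using that by (simp add: binomial_expansion_def)
  have **: "k (Suc d) choose Suc d < n" if "binomial_expansion (Suc d) n \<delta> k" "\<delta> \<noteq> Suc d" for \<delta> k
    using binomial_expansion_pos[OF binomial_expansion_Suc[OF that]] by simp
  show ?case
  proof (cases "\<delta> = Suc d")
    case True
    then have "\<delta>' = Suc d" using *[of k] **[OF Suc.prems(2)] Suc.prems(1) top by fastforce
    then show ?thesis using True top by simp
  next
    case False
    then have F': "\<delta>' \<noteq> Suc d" using *[of k'] **[OF Suc.prems(1)] Suc.prems(2) top by fastforce
    show ?thesis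
      using Suc.IH[OF binomial_expansion_Suc[OF Suc.prems(1) False]]
        binomial_expansion_Suc[OF Suc.prems(2) F'] top
      by (auto simp: le_Suc_eq)
  qed
qed

lemma binomial_expansion_exists:
  assumes "1 \<le> d" "1 \<le> n"
  shows "\<exists>\<delta> k. binomial_expansion d n \<delta> k"
  using assms
proof (induction d arbitrary: n)
  case 0
  then show ?case by simp
next
  case (Suc d)
  have bound: "K \<le> n + Suc d" if "K choose Suc d \<le> n" for K
  proof (rule ccontr)
    assume "\<not> K \<le> n + Suc d"
    then have "Suc (n + d) choose Suc d \<le> K choose Suc d" by (intro binomial_right_mono) simp
    moreover have "n + 1 \<le> Suc (n + d) choose Suc d"
    proof (induction n)
      case (Suc n)
      have "0 < Suc (n + d) choose d" by (intro zero_less_binomial) simp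
      moreover have "Suc (Suc n + d) choose Suc d =
          (Suc (n + d) choose d) + (Suc (n + d) choose Suc d)" by simp
      ultimately show ?case using Suc.IH by linarith
    qed simp
    ultimately show False using that by simp
  qed
  define K where "K = (GREATEST K. K choose Suc d \<le> n)"
  have K: "K choose Suc d \<le> n" unfolding K_def
    by (rule GreatestI_nat[where k = 0 and b = "n + Suc d"]) (use bound in auto)
  have max: "K' \<le> K" if "K' choose Suc d \<le> n" for K' unfolding K_def
    by (rule Greatest_le_nat[where b = "n + Suc d"]) (use that bound in auto)
  have Kd: "Suc d \<le> K" using max[of "Suc d"] Suc.prems by simp
  have r: "n - (K choose Suc d) < K choose d" using max[of "Suc K"] K by fastforce
  show ?case
  proof (cases "n = K choose Suc d")
    case True
    then have "binomial_expansion (Suc d) n (Suc d) (\<lambda>_. K)"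
      using Kd by (simp add: binomial_expansion_def)
    then show ?thesis by blast
  next
    case False
    then have "d \<noteq> 0" using r K by (cases d) auto
    then have "1 \<le> d" "1 \<le> n - (K choose Suc d)" using False K by auto
    then obtain \<delta> k where k: "binomial_expansion d (n - (K choose Suc d)) \<delta> k"
      using Suc.IH by blast
    have "k d choose d < K choose d" using binomial_expansion_ge[OF k] r by simp
    then have "k d < K" using binomial_right_mono[of K "k d" d] by (meson not_less)
    moreover have "(\<Sum>i=\<delta>..d. (k(Suc d := K)) i choose i) = (\<Sum>i=\<delta>..d. k i choose i)"
      by (intro sum.cong) auto
    ultimately have "binomial_expansion (Suc d) n \<delta> (k(Suc d := K))"
      using k K by (auto simp: binomial_expansion_def less_Suc_eq)
    then show ?thesis by blast
  qed
qed

lemma macaulay_growth_eq: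
  assumes "binomial_expansion d n \<delta> k"
  shows "macaulay_growth d n = (\<Sum>i=\<delta>..d. (k i + 1) choose (i + 1))"
proof -
  have "m = (\<Sum>i=\<delta>..d. (k i + 1) choose (i + 1))"
    if "binomial_expansion d n \<delta>' k'" "m = (\<Sum>i=\<delta>'..d. (k' i + 1) choose (i + 1))" for m \<delta>' k'
    using binomial_expansion_unique[OF assms that(1)] that(2) by (auto intro!: sum.cong)
  then have "(THE m. \<exists>\<delta> k. binomial_expansion d n \<delta> k \<and>
      m = (\<Sum>i=\<delta>..d. (k i + 1) choose (i + 1))) = (\<Sum>i=\<delta>..d. (k i + 1) choose (i + 1))"
    using assms by (intro the_equality) blast+
  then show ?thesis
    using binomial_expansion_pos[OF assms] by (simp only: macaulay_growth_def if_False less_not_refl2)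
qed

text \<open>
  A sequence \<open>(h\<^sub>0, \<dots>, h\<^sub>e)\<close> is given by its last index \<open>e\<close> and a function on the naturals whose
  values beyond \<open>e\<close> are irrelevant. Entries are integers because an \<open>O_sequence\<close> has to be tested
  on difference sequences, whose entries may be negative.
\<close>

definition O_sequence :: "nat \<Rightarrow> (nat \<Rightarrow> int) \<Rightarrow> bool" where
  "O_sequence e h \<longleftrightarrow>
     h 0 = 1 \<and> (\<forall>i\<le>e. 0 \<le> h i) \<and>
     (\<forall>d. 1 \<le> d \<and> d < e \<longrightarrow> h (d + 1) \<le> int (macaulay_growth d (nat (h d))))"

text \<open>
  A monomial is the multiset of its variables with multiplicity: divisibility is \<open>\<subseteq>#\<close> and the
  degree is \<open>size\<close>.
\<close>

definition order_ideal :: "'v multiset set \<Rightarrow> bool" where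
  "order_ideal M \<longleftrightarrow> finite M \<and> M \<noteq> {} \<and> (\<forall>m\<in>M. \<forall>m'. m' \<subseteq># m \<longrightarrow> m' \<in> M)"

definition maximal_monomial :: "'v multiset set \<Rightarrow> 'v multiset \<Rightarrow> bool" where
  "maximal_monomial M m \<longleftrightarrow> m \<in> M \<and> (\<forall>m'\<in>M. m \<subseteq># m' \<longrightarrow> m' = m)"

definition pure_order_ideal :: "nat \<Rightarrow> 'v multiset set \<Rightarrow> bool" where
  "pure_order_ideal e M \<longleftrightarrow> order_ideal M \<and> (\<forall>m. maximal_monomial M m \<longrightarrow> size m = e)"

text \<open>Finitely many monomials involve finitely many variables, so variables indexed by \<open>nat\<close>
  suffice.\<close>

definition pure_O_sequence :: "nat \<Rightarrow> (nat \<Rightarrow> nat) \<Rightarrow> bool" where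
  "pure_O_sequence e h \<longleftrightarrow>
     (\<exists>M :: nat multiset set. pure_order_ideal e M \<and> (\<forall>i\<le>e. h i = card {m \<in> M. size m = i}))"

definition nondecreasing_seq :: "nat \<Rightarrow> (nat \<Rightarrow> nat) \<Rightarrow> bool" where
  "nondecreasing_seq e h \<longleftrightarrow> (\<forall>i<e. h i \<le> h (i + 1))"

definition differentiable_seq :: "nat \<Rightarrow> (nat \<Rightarrow> nat) \<Rightarrow> bool" where
  "differentiable_seq e h \<longleftrightarrow>
     O_sequence e (\<lambda>i. if i = 0 then int (h 0) else int (h i) - int (h (i - 1)))"

end

theory Submission
  imports Defs "HOL-Library.Multiset_Order"
begin

text \<open>
  Let \<open>\<ell>\<close> be the sum of the variables, acting on the algebra \<open>R\<close> spanned by the monomials of the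
  order ideal, with multiplication truncated to it. Purity makes multiplication by \<open>\<ell>\<close> injective
  from degree \<open>d - 1\<close> to degree \<open>d\<close> for \<open>d \<le> 2\<close> and \<open>d < e\<close>. Hence \<open>R / \<ell>R\<close> has dimension
  \<open>h\<^sub>d - h\<^sub>d\<^sub>-\<^sub>1\<close> in degree \<open>d\<close> and at least \<open>h\<^sub>d\<^sub>+\<^sub>1 - h\<^sub>d\<close> in degree \<open>d + 1\<close>, and Macaulay's
  theorem bounds the latter in terms of the former.

  To reduce to monomials, \<open>R / \<ell>R\<close> is replaced by its inverse system: the functions on the monomials
  of a given degree that are annihilated by contraction with \<open>\<ell>\<close>. In each degree, the leading
  monomials of this space are as many as its dimension, and they are closed under division.
  Macaulay's bound for monomials of degrees 2 and 3 follows by removing a variable that divides few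
  of the quadrics.
\<close>

section \<open>Macaulay's bound for quadrics and cubics\<close>

lemma choose_two_Suc: "Suc n choose 2 = n + (n choose 2)"
  by (simp add: numeral_2_eq_2)

lemma choose_three_Suc: "Suc n choose 3 = (n choose 2) + (n choose 3)"
  by (simp add: numeral_2_eq_2 numeral_3_eq_3)

lemma choose_two_add: "(a + b) choose 2 = (a choose 2) + (b choose 2) + a * b"
  by (induction a) (simp_all add: choose_two_Suc)

lemma ex_choose_two_add: "\<exists>k j. j < k \<and> n = (k choose 2) + j"
proof (induction n)
  case 0
  show ?case by (rule exI[of _ 1]) simp
next
  case (Suc n)
  then obtain k j where expansion: "j < k" "n = (k choose 2) + j" by blast
  show ?case
  proof (cases "Suc j = k")
    case True
    then have "0 < Suc k \<and> Suc n = (Suc k choose 2) + 0"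
      using expansion by (simp add: choose_two_Suc)
    then show ?thesis by blast
  next
    case False
    then have "Suc j < k \<and> Suc n = (k choose 2) + Suc j" using expansion by simp
    then show ?thesis by blast
  qed
qed

lemma macaulay_growth_one: "macaulay_growth 1 n = Suc n choose 2"
proof (cases "n = 0")
  case True
  then show ?thesis by (simp add: macaulay_growth_def)
next
  case False
  then have "binomial_expansion 1 n 1 (\<lambda>_. n)" by (simp add: binomial_expansion_def)
  from macaulay_growth_eq[OF this] show ?thesis by (simp add: numeral_2_eq_2)
qed

lemma macaulay_growth_two:
  assumes "j < k"
  shows "macaulay_growth 2 ((k choose 2) + j) = (Suc k choose 3) + (Suc j choose 2)"
proof -
  consider (zero) "k = 1" "j = 0" | (one_term) "2 \<le> k" "j = 0" | (two_terms) "0 < j"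
    using assms by linarith
  then show ?thesis
  proof cases
    case zero
    then show ?thesis by (simp add: macaulay_growth_def)
  next
    case one_term
    then have "binomial_expansion 2 ((k choose 2) + j) 2 (\<lambda>_. k)"
      by (simp add: binomial_expansion_def)
    from macaulay_growth_eq[OF this] show ?thesis using one_term by simp
  next
    case two_terms
    define c where "c i = (if i = 1 then j else k)" for i :: nat
    have "binomial_expansion 2 ((k choose 2) + j) 1 c"
      using two_terms assms by (auto simp: binomial_expansion_def c_def numeral_2_eq_2)
    from macaulay_growth_eq[OF this] show ?thesis
      by (simp add: c_def numeral_2_eq_2 numeral_3_eq_3)
  qed
qed

lemma macaulay_growth_two_add:
  assumes "j < k" "l < k" "n + l = (k choose 2) + j"
  shows "macaulay_growth 2 n + (Suc l choose 2) \<le> macaulay_growth 2 (n + l)"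
proof (cases "l \<le> j")
  case True
  then obtain i where i: "j = l + i" using le_Suc_ex by blast
  then have "macaulay_growth 2 n = (Suc k choose 3) + (Suc i choose 2)"
    using macaulay_growth_two[of i k] assms by simp
  moreover have "(Suc i choose 2) + (Suc l choose 2) \<le> Suc j choose 2"
    using choose_two_add[of "Suc l" i] by (simp add: i choose_two_Suc)
  ultimately show ?thesis using macaulay_growth_two[OF assms(1)] assms(3) by simp
next
  case False
  then obtain i where i: "l = j + i" using le_Suc_ex[of j l] by auto
  obtain t where t: "k = Suc (l + t)" using assms(2) less_imp_Suc_add by blast
  have "n = ((l + t) choose 2) + (j + t)" using assms(3) by (simp add: i t choose_two_Suc)
  then have "macaulay_growth 2 n = (k choose 3) + (Suc (j + t) choose 2)"
    using macaulay_growth_two[of "j + t" "l + t"] False t by simp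
  moreover have "macaulay_growth 2 (n + l) = (k choose 2) + (k choose 3) + (Suc j choose 2)"
    using macaulay_growth_two[OF assms(1)] assms(3) by (simp add: choose_three_Suc)
  moreover have "(Suc (j + t) choose 2) + (Suc l choose 2) \<le> (k choose 2) + (Suc j choose 2)"
    using choose_two_add[of i "Suc (j + t)"] choose_two_add[of i "Suc j"]
    by (simp add: i t add.commute add.left_commute)
  ultimately show ?thesis by linarith
qed

definition shadow :: "'v multiset set \<Rightarrow> 'v multiset set" where
  "shadow A = {m. \<exists>v. add_mset v m \<in> A}"

definition link :: "'v \<Rightarrow> 'v multiset set \<Rightarrow> 'v multiset set" where
  "link v A = {m. add_mset v m \<in> A}"

definition deletion :: "'v \<Rightarrow> 'v multiset set \<Rightarrow> 'v multiset set" where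
  "deletion v A = {m \<in> A. v \<notin># m}"

lemma link_subset_shadow: "link v A \<subseteq> shadow A"
  by (auto simp: link_def shadow_def)

lemma shadow_nonempty:
  assumes "m \<in> A" "m \<noteq> {#}"
  shows "shadow A \<noteq> {}"
proof -
  obtain v n where "m = add_mset v n" using assms(2) by (cases m) auto
  then show ?thesis using assms(1) by (auto simp: shadow_def)
qed

lemma shadow_link: "shadow (link v A) \<subseteq> link v (shadow A)"
  by (auto simp: link_def shadow_def add_mset_commute)

lemma shadow_deletion: "shadow (deletion v A) \<subseteq> deletion v (shadow A)"
  by (auto simp: deletion_def shadow_def)

lemma link_mono: "A \<subseteq> B \<Longrightarrow> link v A \<subseteq> link v B"
  by (auto simp: link_def)

lemma deletion_mono: "A \<subseteq> B \<Longrightarrow> deletion v A \<subseteq> deletion v B"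
  by (auto simp: deletion_def)

lemma add_mset_image_link: "add_mset v ` link v A = {m \<in> A. v \<in># m}"
  by (auto simp: link_def image_iff dest: multi_member_split)

lemma finite_link: "finite A \<Longrightarrow> finite (link v A)"
  by (rule finite_imageD[of "add_mset v"]) (simp_all add: add_mset_image_link inj_on_def)

lemma card_link_deletion:
  assumes "finite A"
  shows "card A = card (link v A) + card (deletion v A)"
proof -
  have "A = {m \<in> A. v \<in># m} \<union> deletion v A" "{m \<in> A. v \<in># m} \<inter> deletion v A = {}"
    by (auto simp: deletion_def)
  then have "card A = card {m \<in> A. v \<in># m} + card (deletion v A)"
    using assms by (metis card_Un_disjoint finite_Un)
  then show ?thesis by (simp flip: add_mset_image_link add: card_image inj_on_def)
qed

lemma card_quadrics_le:
  assumes "finite A" "finite B" "\<And>m. m \<in> A \<Longrightarrow> size m = 2" "shadow A \<subseteq> B"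
  shows "card A \<le> Suc (card B) choose 2"
  using assms
proof (induction "card B" arbitrary: A B rule: less_induct)
  case less
  show ?case
  proof (cases "A = {}")
    case False
    then obtain m where "m \<in> A" by blast
    then obtain u n where "m = add_mset u n" "size n = 1"
      using less.prems(3) by (metis Suc_1 size_eq_Suc_imp_eq_union size_add_mset nat.inject)
    moreover from this obtain v where "n = {#v#}" using size_1_singleton_mset by blast
    ultimately have "{#v#} \<in> B" using \<open>m \<in> A\<close> less.prems(4) by (auto simp: shadow_def)
    then have card_B: "card B = Suc (card (B - {{#v#}}))"
      using less.prems(2) by (metis card_Suc_Diff1)
    have "shadow (deletion v A) \<subseteq> B - {{#v#}}"
      using shadow_deletion[of v A] less.prems(4) by (auto simp: deletion_def)
    then have "card (deletion v A) \<le> card B choose 2"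
      using less.hyps[of "B - {{#v#}}" "deletion v A"] less.prems card_B by (simp add: deletion_def)
    moreover have "card (link v A) \<le> card B"
      using link_subset_shadow[of v A] less.prems by (intro card_mono) auto
    ultimately show ?thesis
      using card_link_deletion[OF less.prems(1), of v] by (simp add: choose_two_Suc)
  qed simp
qed

lemma choose_two_le_card_if_links_ge:
  assumes "finite B" "\<And>m. m \<in> B \<Longrightarrow> size m = 2"
    and "finite S" "k \<le> card S" "\<And>v. v \<in> S \<Longrightarrow> k \<le> card (link v B)"
  shows "Suc k choose 2 \<le> card B"
  using assms
proof (induction k arbitrary: B S)
  case 0
  then show ?case by (simp add: binomial_eq_0)
next
  case (Suc k)
  then obtain v where v_in_S: "v \<in> S" by fastforce
  have "k \<le> card (link u (deletion v B))" if u_in_S: "u \<in> S - {v}" for u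
  proof -
    have "m = {#v#}" if "m \<in> link u B" "v \<in># m" for m
    proof -
      have "size m = 1" using that(1) Suc.prems(2) by (fastforce simp: link_def)
      then obtain w where "m = {#w#}" using size_1_singleton_mset by blast
      then show ?thesis using that(2) by simp
    qed
    then have "link u B \<subseteq> insert {#v#} (link u (deletion v B))"
      using u_in_S by (auto simp: link_def deletion_def)
    then have "card (link u B) \<le> card (insert {#v#} (link u (deletion v B)))"
      using Suc.prems(1) by (intro card_mono) (simp_all add: finite_link deletion_def)
    also have "\<dots> \<le> Suc (card (link u (deletion v B)))" by (rule card_insert_le_m1) simp_all
    finally show ?thesis using Suc.prems(5)[of u] u_in_S by simp
  qed
  moreover have "k \<le> card (S - {v})" using v_in_S Suc.prems(3,4) by simp
  ultimately have "Suc k choose 2 \<le> card (deletion v B)"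
    using Suc.prems by (intro Suc.IH[of _ "S - {v}"]) (auto simp: deletion_def)
  then show ?case
    using Suc.prems(5)[OF v_in_S] card_link_deletion[OF Suc.prems(1), of v]
    by (simp add: choose_two_Suc[of "Suc k"])
qed

lemma ex_small_link:
  assumes "finite B" "\<And>m. m \<in> B \<Longrightarrow> size m = 2" "B \<noteq> {}" "card B < Suc k choose 2"
  shows "\<exists>v. link v B \<noteq> {} \<and> card (link v B) < k"
proof (rule ccontr)
  assume no_small: "\<nexists>v. link v B \<noteq> {} \<and> card (link v B) < k"
  define S where "S = (\<Union>m\<in>B. set_mset m)"
  have finite_S: "finite S" using assms(1) by (simp add: S_def)
  have large: "k \<le> card (link v B)" if "v \<in> S" for v
  proof -
    have "link v B \<noteq> {}" using that by (auto simp: S_def link_def dest: multi_member_split)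
    then show ?thesis using no_small by (meson not_le)
  qed
  obtain m where "m \<in> B" using assms(3) by blast
  then have "m \<noteq> {#}" using assms(2) by fastforce
  then obtain v where "v \<in># m" by (rule multiset_nonemptyE)
  then have "v \<in> S" using \<open>m \<in> B\<close> by (auto simp: S_def)
  have "link v B \<subseteq> (\<lambda>u. {#u#}) ` S"
  proof
    fix n assume "n \<in> link v B"
    then have n_in_link: "add_mset v n \<in> B" by (simp add: link_def)
    then have "size n = 1" using assms(2) by fastforce
    then obtain u where "n = {#u#}" using size_1_singleton_mset by blast
    moreover from this have "u \<in> S" unfolding S_def
      using n_in_link by (intro UN_I[of "add_mset v n"]) auto
    ultimately show "n \<in> (\<lambda>u. {#u#}) ` S" by blast
  qed
  then have "k \<le> card S"
    using large[OF \<open>v \<in> S\<close>] surj_card_le[OF finite_S] by (meson order_trans)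
  then have "Suc k choose 2 \<le> card B"
    using choose_two_le_card_if_links_ge[OF assms(1,2) finite_S] large by blast
  then show False using assms(4) by simp
qed

lemma card_cubics_le:
  assumes "finite A" "finite B" "\<And>m. m \<in> A \<Longrightarrow> size m = 3" "\<And>m. m \<in> B \<Longrightarrow> size m = 2"
    and "shadow A \<subseteq> B"
  shows "card A \<le> macaulay_growth 2 (card B)"
  using assms
proof (induction "card B" arbitrary: A B rule: less_induct)
  case less
  show ?case
  proof (cases "B = {}")
    case True
    have "m \<noteq> {#}" if "m \<in> A" for m using less.prems(3)[OF that] by auto
    then have "A = {}" using shadow_nonempty less.prems(5) True by blast
    then show ?thesis by simp
  next
    case False
    obtain k j where expansion: "j < k" "card B = (k choose 2) + j" using ex_choose_two_add by blast
    then have "card B < Suc k choose 2" by (simp add: choose_two_Suc)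
    then obtain v where small: "link v B \<noteq> {}" "card (link v B) < k"
      using ex_small_link less.prems(2,4) False by metis
    have card_B: "card B = card (deletion v B) + card (link v B)"
      using card_link_deletion[OF less.prems(2), of v] by simp
    have "card (link v A) \<le> Suc (card (link v B)) choose 2"
    proof (rule card_quadrics_le)
      show "shadow (link v A) \<subseteq> link v B"
        by (rule order_trans[OF shadow_link link_mono[OF less.prems(5)]])
      show "size m = 2" if "m \<in> link v A" for m
        using that less.prems(3) by (fastforce simp: link_def)
    qed (use less.prems(1,2) in \<open>simp_all add: finite_link\<close>)
    moreover have "card (deletion v A) \<le> macaulay_growth 2 (card (deletion v B))"
    proof (rule less.hyps)
      have "0 < card (link v B)"
        using small(1) finite_link[OF less.prems(2)] by (simp add: card_gt_0_iff)
      then show "card (deletion v B) < card B" using card_B by simp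
      show "shadow (deletion v A) \<subseteq> deletion v B"
        by (rule order_trans[OF shadow_deletion deletion_mono[OF less.prems(5)]])
    qed (use less.prems in \<open>auto simp: deletion_def\<close>)
    moreover have "macaulay_growth 2 (card (deletion v B)) + (Suc (card (link v B)) choose 2)
        \<le> macaulay_growth 2 (card B)"
      using macaulay_growth_two_add[OF expansion(1) small(2)] expansion(2) card_B by simp
    ultimately show ?thesis
      using card_link_deletion[OF less.prems(1), of v] by linarith
  qed
qed

lemma card_le_macaulay_growth:
  assumes "d = 1 \<or> d = 2" "finite A" "finite B"
    and "\<And>m. m \<in> A \<Longrightarrow> size m = Suc d" "\<And>m. m \<in> B \<Longrightarrow> size m = d" "shadow A \<subseteq> B"
  shows "card A \<le> macaulay_growth d (card B)"
  using assms(1)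
proof
  assume "d = 1"
  then show ?thesis
    using card_quadrics_le[OF assms(2,3) _ assms(6)] assms(4) macaulay_growth_one by simp
next
  assume "d = 2"
  then show ?thesis using card_cubics_le[OF assms(2,3) _ _ assms(6)] assms(4,5) by simp
qed

section \<open>Initial monomials of the inverse system\<close>

lemma nontrivial_common_zero:
  fixes T :: "'b \<Rightarrow> ('a \<Rightarrow> 'c::field) \<Rightarrow> 'c"
  assumes "finite B" "card B < card A"
    and linear: "\<And>b x y f g. b \<in> B \<Longrightarrow> T b (\<lambda>a. x * f a + y * g a) = x * T b f + y * T b g"
  obtains f a where "f a \<noteq> 0" "\<And>a. a \<notin> A \<Longrightarrow> f a = 0" "\<And>b. b \<in> B \<Longrightarrow> T b f = 0"
proof -
  have "\<exists>f. (\<exists>a. f a \<noteq> 0) \<and> (\<forall>a. a \<notin> A \<longrightarrow> f a = 0) \<and> (\<forall>b\<in>B. T b f = 0)"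
    using assms
  proof (induction B arbitrary: A rule: finite_induct)
    case empty
    then obtain a where "a \<in> A" by fastforce
    then show ?case by (intro exI[of _ "\<lambda>c. of_bool (c = a)"]) auto
  next
    case (insert b B)
    note IH = insert.IH[OF _ insert.prems(2)]
    have B_small: "Suc (card B) < card A" using insert.hyps insert.prems(1) by simp
    with IH[of A] obtain f a where f: "f a \<noteq> 0" "\<forall>a. a \<notin> A \<longrightarrow> f a = 0" "\<forall>b\<in>B. T b f = 0"
      by auto
    then have "a \<in> A" by blast
    then have "card B < card (A - {a})" using B_small by (simp add: card_Diff_singleton)
    with IH[of "A - {a}"] obtain g
      where g: "\<exists>c. g c \<noteq> 0" "\<forall>c. c \<notin> A - {a} \<longrightarrow> g c = 0" "\<forall>b\<in>B. T b g = 0"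
      by auto
    show ?case
    proof (cases "T b g = 0")
      case True
      then show ?thesis using g by (intro exI[of _ g]) auto
    next
      case False
      define h where "h c = T b g * f c + (- T b f) * g c" for c
      have "T b' h = T b g * T b' f + (- T b f) * T b' g" if "b' \<in> insert b B" for b'
        unfolding h_def using that by (rule insert.prems(2))
      then have "\<forall>b'\<in>insert b B. T b' h = 0" using f(3) g(3) by simp
      moreover have "h a \<noteq> 0" using False f(1) g(2) by (simp add: h_def)
      moreover have "\<forall>c. c \<notin> A \<longrightarrow> h c = 0" using f(2) g(2) by (simp add: h_def)
      ultimately show ?thesis by blast
    qed
  qed
  then show ?thesis using that by blast
qed

text \<open>The linear form is the sum of the variables. Contraction takes as parameter a finite set \<open>V\<close>
  containing all variables in question, since sums over infinite sets are \<open>0\<close>.\<close>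

definition form_contract :: "'v set \<Rightarrow> ('v multiset \<Rightarrow> real) \<Rightarrow> 'v multiset \<Rightarrow> real" where
  "form_contract V f n = (\<Sum>v\<in>V. f (add_mset v n))"

definition form_times :: "('v multiset \<Rightarrow> real) \<Rightarrow> 'v multiset \<Rightarrow> real" where
  "form_times c m = (\<Sum>v\<in>set_mset m. c (m - {#v#}))"

definition inverse_system :: "'v set \<Rightarrow> 'v multiset set \<Rightarrow> ('v multiset \<Rightarrow> real) set" where
  "inverse_system V A = {f. (\<forall>m. m \<notin> A \<longrightarrow> f m = 0) \<and> (\<forall>n. form_contract V f n = 0)}"

definition initial_monomials ::
    "('v::linorder multiset \<Rightarrow> real) set \<Rightarrow> 'v multiset set" where
  "initial_monomials K = {m. \<exists>f\<in>K. f m \<noteq> 0 \<and> (\<forall>m'>m. f m' = 0)}"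

lemma form_contract_linear:
  "form_contract V (\<lambda>m. x * f m + y * g m) n = x * form_contract V f n + y * form_contract V g n"
  by (simp add: form_contract_def sum.distrib sum_distrib_left)

lemma form_times_linear:
  "form_times (\<lambda>n. x * c n + y * d n) m = x * form_times c m + y * form_times d m"
  by (simp add: form_times_def sum.distrib sum_distrib_left)

lemma form_times_adjoint:
  assumes "finite V" "finite A" "finite B"
    and vars: "\<And>m. m \<in> A \<Longrightarrow> set_mset m \<subseteq> V"
    and shadow: "shadow A \<subseteq> B"
    and support: "\<And>m. m \<notin> A \<Longrightarrow> f m = 0"
  shows "(\<Sum>m\<in>A. form_times c m * f m) = (\<Sum>n\<in>B. c n * form_contract V f n)"
proof -
  have "(\<Sum>m\<in>A. form_times c m * f m) = (\<Sum>m\<in>A. \<Sum>v | v \<in> V \<and> v \<in># m. c (m - {#v#}) * f m)"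
    unfolding form_times_def sum_distrib_right using vars by (intro sum.cong) auto
  also have "\<dots> = (\<Sum>v\<in>V. \<Sum>m | m \<in> A \<and> v \<in># m. c (m - {#v#}) * f m)"
    by (rule sum.swap_restrict[OF assms(2,1)])
  also have "\<dots> = (\<Sum>v\<in>V. \<Sum>n\<in>link v A. c n * f (add_mset v n))"
    by (simp flip: add_mset_image_link add: sum.reindex inj_on_def)
  also have "\<dots> = (\<Sum>v\<in>V. \<Sum>n\<in>B. c n * f (add_mset v n))"
  proof (rule sum.cong[OF refl], rule sum.mono_neutral_left)
    show "link v A \<subseteq> B" for v by (rule order_trans[OF link_subset_shadow shadow])
  qed (use assms(3) support in \<open>auto simp: link_def\<close>)
  also have "\<dots> = (\<Sum>n\<in>B. c n * form_contract V f n)"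
    unfolding form_contract_def sum_distrib_left by (rule sum.swap)
  finally show ?thesis .
qed

lemma initial_monomials_subset: "initial_monomials (inverse_system V A) \<subseteq> A"
  by (auto simp: initial_monomials_def inverse_system_def)

text \<open>Contraction by a variable divides the leading monomial by it.\<close>

lemma shadow_initial_monomials:
  assumes "shadow A \<subseteq> B"
  shows "shadow (initial_monomials (inverse_system V A)) \<subseteq> initial_monomials (inverse_system V B)"
proof
  fix n assume "n \<in> shadow (initial_monomials (inverse_system V A))"
  then obtain v f where f: "f \<in> inverse_system V A" "f (add_mset v n) \<noteq> 0"
    and lead: "\<And>m'. add_mset v n < m' \<Longrightarrow> f m' = 0"
    by (auto simp: shadow_def initial_monomials_def)
  define g where "g m = f (add_mset v m)" for m
  have "form_contract V g m = form_contract V f (add_mset v m)" for m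
    by (simp add: form_contract_def g_def add_mset_commute)
  moreover have "g m = 0" if "m \<notin> B" for m
    using that f(1) assms by (auto simp: g_def inverse_system_def shadow_def)
  ultimately have "g \<in> inverse_system V B" using f(1) by (simp add: inverse_system_def)
  moreover have "g n \<noteq> 0" using f(2) by (simp add: g_def)
  moreover have "g m' = 0" if "n < m'" for m'
    using lead[OF add_mset_lt_right_lt[OF that]] by (simp add: g_def)
  ultimately show "n \<in> initial_monomials (inverse_system V B)"
    by (auto simp: initial_monomials_def)
qed

lemma ex_initial_monomial:
  assumes "finite A" "f \<in> inverse_system V A" "f m \<noteq> 0"
  obtains l where "l \<in> initial_monomials (inverse_system V A)" "f l \<noteq> 0"
proof -
  have support: "m \<in> A" if "f m \<noteq> 0" for m using that assms(2) by (auto simp: inverse_system_def)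
  have "finite {m \<in> A. f m \<noteq> 0}" "{m \<in> A. f m \<noteq> 0} \<noteq> {}" using assms(1,3) support by auto
  then obtain l where "f l \<noteq> 0" "\<And>m. m \<in> A \<Longrightarrow> f m \<noteq> 0 \<Longrightarrow> \<not> l < m"
    using finite_has_maximal[of "{m \<in> A. f m \<noteq> 0}"] by (auto simp: less_le)
  moreover from this have "\<forall>m>l. f m = 0" using support by blast
  ultimately show ?thesis using that assms(2) by (auto simp: initial_monomials_def)
qed

lemma card_Diff_initial_monomials:
  assumes "finite A"
  shows "card (A - initial_monomials (inverse_system V A))
       = card A - card (initial_monomials (inverse_system V A))"
  using assms initial_monomials_subset by (metis card_Diff_subset finite_subset)

lemma card_le_card_initial_monomials:
  assumes "finite A" "finite B" "shadow A \<subseteq> B"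
  shows "card A \<le> card B + card (initial_monomials (inverse_system V A))"
proof (rule ccontr)
  let ?I = "initial_monomials (inverse_system V A)"
  assume "\<not> card A \<le> card B + card ?I"
  then have "card B < card (A - ?I)" using card_Diff_initial_monomials[OF assms(1), of V] by simp
  then obtain f m where nonzero: "f m \<noteq> 0" and support: "\<And>m. m \<notin> A - ?I \<Longrightarrow> f m = 0"
    and contract: "\<And>n. n \<in> B \<Longrightarrow> form_contract V f n = 0"
    using nontrivial_common_zero[where T = "\<lambda>n f. form_contract V f n", OF assms(2)
        _ form_contract_linear] by blast
  have "form_contract V f n = 0" if "n \<notin> B" for n
    using that assms(3) support by (auto simp: form_contract_def shadow_def intro!: sum.neutral)
  then have "f \<in> inverse_system V A" using support contract by (auto simp: inverse_system_def)
  then obtain l where "l \<in> ?I" "f l \<noteq> 0" using ex_initial_monomial[OF assms(1)] nonzero by blast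
  then show False using support by blast
qed

definition form_injective :: "'v multiset set \<Rightarrow> 'v multiset set \<Rightarrow> bool" where
  "form_injective B A \<longleftrightarrow>
     (\<forall>c. (\<forall>n. n \<notin> B \<longrightarrow> c n = 0) \<longrightarrow> (\<forall>m\<in>A. form_times c m = 0) \<longrightarrow> (\<forall>n\<in>B. c n = 0))"

text \<open>Multiples of the form are orthogonal to the inverse system, so the least monomial of a
  multiple is not a leading monomial of the inverse system.\<close>

lemma form_times_eq_0_if_eq_0_off_initial_monomials:
  assumes "finite V" "finite A" "finite B"
    and vars: "\<And>m. m \<in> A \<Longrightarrow> set_mset m \<subseteq> V"
    and shadow: "shadow A \<subseteq> B"
    and off_initial: "\<And>m. m \<in> A - initial_monomials (inverse_system V A) \<Longrightarrow> form_times c m = 0"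
    and "m \<in> A"
  shows "form_times c m = 0"
proof (rule ccontr)
  assume "form_times c m \<noteq> 0"
  then have "{m \<in> A. form_times c m \<noteq> 0} \<noteq> {}" using \<open>m \<in> A\<close> by blast
  then obtain l where l: "l \<in> A" "form_times c l \<noteq> 0"
    and below: "\<And>m. m \<in> A \<Longrightarrow> m < l \<Longrightarrow> form_times c m = 0"
    using finite_has_minimal[of "{m \<in> A. form_times c m \<noteq> 0}"] assms(2) by (auto simp: less_le)
  from l off_initial obtain f where f: "f \<in> inverse_system V A" "f l \<noteq> 0"
    and above: "\<And>m. l < m \<Longrightarrow> f m = 0"
    by (fastforce simp: initial_monomials_def)
  have "(\<Sum>m\<in>A. form_times c m * f m) = 0"
    using form_times_adjoint[OF assms(1-3) vars shadow] f(1) by (simp add: inverse_system_def)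
  moreover have "(\<Sum>m\<in>A. form_times c m * f m) = (\<Sum>m\<in>{l}. form_times c m * f m)"
    using assms(2) l(1) below above by (intro sum.mono_neutral_right) (auto simp: neq_iff)
  ultimately show False using l(2) f(2) by simp
qed

lemma card_initial_monomials:
  assumes "finite V" "finite A" "finite B"
    and vars: "\<And>m. m \<in> A \<Longrightarrow> set_mset m \<subseteq> V"
    and shadow: "shadow A \<subseteq> B"
    and injective: "form_injective B A"
  shows "card (initial_monomials (inverse_system V A)) = card A - card B"
proof -
  let ?I = "initial_monomials (inverse_system V A)"
  have "card B \<le> card (A - ?I)"
  proof (rule ccontr)
    assume "\<not> card B \<le> card (A - ?I)"
    then have "card (A - ?I) < card B" by simp
    then obtain c n where nonzero: "c n \<noteq> 0" and support: "\<And>n. n \<notin> B \<Longrightarrow> c n = 0"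
      and "\<And>m. m \<in> A - ?I \<Longrightarrow> form_times c m = 0"
      using nontrivial_common_zero[where T = "\<lambda>m c. form_times c m", OF finite_Diff[OF assms(2)]
          _ form_times_linear] by blast
    then have "\<forall>m\<in>A. form_times c m = 0"
      using form_times_eq_0_if_eq_0_off_initial_monomials[OF assms(1-3) vars shadow] by blast
    then show False using injective nonzero support by (auto simp: form_injective_def)
  qed
  moreover have "card ?I \<le> card A"
    using assms(2) initial_monomials_subset by (rule card_mono)
  moreover have "card A \<le> card B + card ?I"
    using assms(2,3) shadow by (rule card_le_card_initial_monomials)
  ultimately show ?thesis using card_Diff_initial_monomials[OF assms(2), of V] by linarith
qed

section \<open>Pure order ideals\<close>

definition degree_part :: "'v multiset set \<Rightarrow> nat \<Rightarrow> 'v multiset set" where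
  "degree_part M d = {m \<in> M. size m = d}"

lemma order_ideal_subset_mset: "order_ideal M \<Longrightarrow> m \<in> M \<Longrightarrow> n \<subseteq># m \<Longrightarrow> n \<in> M"
  by (auto simp: order_ideal_def)

lemma finite_degree_part: "order_ideal M \<Longrightarrow> finite (degree_part M d)"
  by (simp add: order_ideal_def degree_part_def)

lemma degree_part_0: "order_ideal M \<Longrightarrow> degree_part M 0 = {{#}}"
  by (auto simp: order_ideal_def degree_part_def)

lemma shadow_degree_part:
  assumes "order_ideal M"
  shows "shadow (degree_part M (Suc d)) \<subseteq> degree_part M d"
  using order_ideal_subset_mset[OF assms] by (auto simp: shadow_def degree_part_def)

lemma pure_order_ideal_extend:
  assumes "pure_order_ideal e M" "n \<in> M"
  obtains m where "m \<in> M" "n \<subseteq># m" "size m = e"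
proof -
  have "finite M" using assms(1) by (simp add: pure_order_ideal_def order_ideal_def)
  then obtain m where m: "m \<in> M" "n \<subseteq># m" "\<forall>m'\<in>M. m \<subseteq># m' \<longrightarrow> m = m'"
    using subset_mset.finite_has_maximal2 assms(2) by metis
  then have "maximal_monomial M m" by (auto simp: maximal_monomial_def)
  then show ?thesis using that m(1,2) assms(1) by (simp add: pure_order_ideal_def)
qed

lemma form_injective_degree_part_0:
  assumes "pure_order_ideal e M" "0 < e"
  shows "form_injective (degree_part M 0) (degree_part M 1)"
proof -
  have ideal: "order_ideal M" using assms(1) by (simp add: pure_order_ideal_def)
  have "{#} \<in> M" using degree_part_0[OF ideal] by (auto simp: degree_part_def)
  then obtain m where "m \<in> M" "size m = e" using pure_order_ideal_extend[OF assms(1)] by metis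
  moreover from this obtain v where "v \<in># m" using assms(2) by fastforce
  ultimately have "{#v#} \<in> degree_part M 1"
    using order_ideal_subset_mset[OF ideal] by (simp add: degree_part_def)
  moreover have "form_times c {#v#} = c {#}" for c by (simp add: form_times_def)
  ultimately show ?thesis unfolding form_injective_def degree_part_0[OF ideal] by auto
qed

text \<open>A variable \<open>x\<close> divides some \<open>x y z\<close>, and \<open>c x + c y = c x + c z = c y + c z = 0\<close> forces
  \<open>c x = 0\<close>.\<close>

lemma form_injective_degree_part_1:
  assumes "pure_order_ideal e M" "3 \<le> e"
  shows "form_injective (degree_part M 1) (degree_part M 2)"
  unfolding form_injective_def
proof (intro allI impI ballI)
  have ideal: "order_ideal M" using assms(1) by (simp add: pure_order_ideal_def)
  fix c n assume times_zero: "\<forall>m\<in>degree_part M 2. form_times c m = 0" and "n \<in> degree_part M 1"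
  then have "size n = 1" "n \<in> M" by (auto simp: degree_part_def)
  then obtain x where x: "n = {#x#}" using size_1_singleton_mset by blast
  obtain m where m: "m \<in> M" "n \<subseteq># m" "size m = e"
    using pure_order_ideal_extend[OF assms(1) \<open>n \<in> M\<close>] .
  then obtain r where r: "m = add_mset x r" by (auto simp: x dest: multi_member_split)
  then have "size r = Suc (Suc (e - 3))" using m(3) assms(2) by simp
  then obtain y r' where "r = add_mset y r'" "size r' = Suc (e - 3)"
    by (metis size_eq_Suc_imp_eq_union size_add_mset nat.inject)
  moreover from this obtain z s where "r' = add_mset z s" using size_eq_Suc_imp_eq_union by metis
  ultimately have "m = add_mset x (add_mset y (add_mset z s))" using r by simp
  then have "{#x, y#} \<subseteq># m" "{#x, z#} \<subseteq># m" "{#y, z#} \<subseteq># m" by auto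
  then have "{#x, y#} \<in> degree_part M 2" "{#x, z#} \<in> degree_part M 2" "{#y, z#} \<in> degree_part M 2"
    using order_ideal_subset_mset[OF ideal m(1)] by (auto simp: degree_part_def)
  moreover have "c {#a#} + c {#b#} = 0" if "{#a, b#} \<in> degree_part M 2" for a b
  proof -
    have "form_times c {#a, b#} = 0" using times_zero that by blast
    then show ?thesis by (cases "a = b") (auto simp: form_times_def)
  qed
  ultimately have "c {#x#} + c {#y#} = 0" "c {#x#} + c {#z#} = 0" "c {#y#} + c {#z#} = 0"
    by blast+
  then show "c n = 0" by (simp add: x)
qed

lemma card_degree_part_growth:
  fixes M :: "'v::linorder multiset set"
  assumes "order_ideal M" "form_injective (degree_part M d) (degree_part M (Suc d))" "d \<le> 1"
  shows "card (degree_part M (Suc (Suc d))) \<le> card (degree_part M (Suc d))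
    + macaulay_growth (Suc d) (card (degree_part M (Suc d)) - card (degree_part M d))"
proof -
  define V where "V = (\<Union>m\<in>M. set_mset m)"
  define I where "I d = initial_monomials (inverse_system V (degree_part M d))" for d
  have "finite V" using assms(1) by (simp add: V_def order_ideal_def)
  note finite_part = finite_degree_part[OF assms(1)]
    and shadow_part = shadow_degree_part[OF assms(1)]
  have I_subset: "I d \<subseteq> degree_part M d" for d unfolding I_def by (rule initial_monomials_subset)
  have "card (degree_part M (Suc (Suc d))) \<le> card (degree_part M (Suc d)) + card (I (Suc (Suc d)))"
    unfolding I_def by (intro card_le_card_initial_monomials finite_part shadow_part)
  also have "card (I (Suc (Suc d))) \<le> macaulay_growth (Suc d) (card (I (Suc d)))"
  proof (rule card_le_macaulay_growth)
    show "shadow (I (Suc (Suc d))) \<subseteq> I (Suc d)"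
      unfolding I_def by (intro shadow_initial_monomials shadow_part)
    show "finite (I (Suc (Suc d)))" "finite (I (Suc d))"
      using I_subset finite_part finite_subset by blast+
  qed (use I_subset assms(3) in \<open>auto simp: degree_part_def\<close>)
  also have "card (I (Suc d)) = card (degree_part M (Suc d)) - card (degree_part M d)"
    unfolding I_def using \<open>finite V\<close> finite_part finite_part _ shadow_part assms(2)
    by (rule card_initial_monomials) (auto simp: V_def degree_part_def)
  finally show ?thesis by simp
qed

lemma differentiable_seq_iff:
  "differentiable_seq e h \<longleftrightarrow> h 0 = 1 \<and> nondecreasing_seq e h \<and>
     (\<forall>d. Suc d < e \<longrightarrow> h (Suc (Suc d)) \<le> h (Suc d) + macaulay_growth (Suc d) (h (Suc d) - h d))"
proof -
  let ?\<Delta> = "\<lambda>i. if i = 0 then int (h 0) else int (h i) - int (h (i - 1))"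
  have "(\<forall>i\<le>e. 0 \<le> ?\<Delta> i) \<longleftrightarrow> nondecreasing_seq e h"
  proof
    assume "\<forall>i\<le>e. 0 \<le> ?\<Delta> i"
    then have "0 \<le> ?\<Delta> (Suc i)" if "i < e" for i using that by (simp only: Suc_le_eq)
    then show "nondecreasing_seq e h" by (simp add: nondecreasing_seq_def)
  next
    assume mono: "nondecreasing_seq e h"
    show "\<forall>i\<le>e. 0 \<le> ?\<Delta> i"
    proof (intro allI impI)
      fix i assume "i \<le> e"
      then show "0 \<le> ?\<Delta> i" using mono by (cases i) (auto simp: nondecreasing_seq_def)
    qed
  qed
  moreover have "(\<forall>d. 1 \<le> d \<and> d < e \<longrightarrow> ?\<Delta> (d + 1) \<le> int (macaulay_growth d (nat (?\<Delta> d)))) \<longleftrightarrow>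
      (\<forall>d. Suc d < e \<longrightarrow> h (Suc (Suc d)) \<le> h (Suc d) + macaulay_growth (Suc d) (h (Suc d) - h d))"
  proof -
    have "(\<forall>d. 1 \<le> d \<and> d < e \<longrightarrow> P d) \<longleftrightarrow> (\<forall>d. Suc d < e \<longrightarrow> P (Suc d))" for P
      by (metis One_nat_def Suc_le_D le_add1 plus_1_eq_Suc)
    moreover have "?\<Delta> (Suc d + 1) \<le> int (macaulay_growth (Suc d) (nat (?\<Delta> (Suc d)))) \<longleftrightarrow>
        h (Suc (Suc d)) \<le> h (Suc d) + macaulay_growth (Suc d) (h (Suc d) - h d)" for d
      by (simp add: nat_diff_distrib' le_diff_eq flip: of_nat_add) linarith
    ultimately show ?thesis by presburger
  qed
  ultimately show ?thesis by (auto simp: differentiable_seq_def O_sequence_def)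
qed

theorem theorem3p3:
  fixes e :: nat and h :: "nat \<Rightarrow> nat"
  assumes "e \<le> 3"
    and "pure_O_sequence e h"
    and "nondecreasing_seq e h"
  shows "differentiable_seq e h"
proof -
  obtain M :: "nat multiset set" where pure: "pure_order_ideal e M"
    and h_eq: "\<And>i. i \<le> e \<Longrightarrow> h i = card (degree_part M i)"
    using assms(2) unfolding pure_O_sequence_def degree_part_def by blast
  then have ideal: "order_ideal M" by (simp add: pure_order_ideal_def)
  have growth: "h (Suc (Suc d)) \<le> h (Suc d) + macaulay_growth (Suc d) (h (Suc d) - h d)"
    if d_less: "Suc d < e" for d
  proof -
    consider "d = 0" | "d = 1" "3 \<le> e" using d_less assms(1) by linarith
    then have "form_injective (degree_part M d) (degree_part M (Suc d))"
      using form_injective_degree_part_0[OF pure] form_injective_degree_part_1[OF pure] d_less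
      by cases (auto simp: numeral_2_eq_2)
    then show ?thesis using card_degree_part_growth[OF ideal] h_eq d_less assms(1) by simp
  qed
  moreover have "h 0 = 1" using h_eq[of 0] degree_part_0[OF ideal] by simp
  ultimately show ?thesis using assms(3) by (simp add: differentiable_seq_iff)
qed

end
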